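(* Let $\mathcal{H}$ be a real Hilbert space, let $K$ be a nonempty closed convex cone in $\mathcal{H}$, let $\rho>0$, and let $B:=\{x\in\mathcal{H}:\|x\|\le\rho\}$. (i) $\mathrm{P}_B\mathrm{P}_K=\mathrm{P}_{K\cap B}$ is a $0$-BAM. (ii) Suppose that $\mathcal{H}=\mathbb{R}^2$, $K=\mathbb{R}^2_+$ (the nonnegative orthant) and $\rho=1$. Then $\mathrm{P}_K\mathrm{P}_B$ is not a BAM.
   Context: For a nonempty closed convex set $C\subseteq\mathcal{H}$, $\mathrm{P}_C$ denotes the metric projection onto $C$. $\operatorname{Fix}G=\{x\in\mathcal{H}: Gx=x\}$. Products of operators denote composition. Definition (BAM). Let $G:\mathcal{H}\to\mathcal{H}$ and $\gamma\in[0,1[$. $G$ is a best approximation mapping with constant $\gamma$ ($\gamma$-BAM) if (1) $\operatorname{Fix}G$ is a nonempty closed convex subset of $\mathcal{H}$; (2) $\mathrm{P}_{\operatorname{Fix}G}G=\mathrm{P}_{\operatorname{Fix}G}$; (3) $\|Gx-\mathrm{P}_{\operatorname{Fix}G}x\|\le\gamma\|x-\mathrm{P}_{\operatorname{Fix}G}x\|$ for all $x\in\mathcal{H}$. $G$ is a BAM if it is a $\gamma$-BAM for some $\gamma\in[0,1[$. *)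

theory Defs
  imports "HOL-Analysis.Analysis"
begin

(* The library's closest_point requires the class heine_borel, hence finite dimension;
   the Hilbert spaces here are arbitrary.  For C nonempty, closed and convex the nearest
   point exists and is unique; otherwise the value may be unspecified. *)
definition metric_proj :: "'a::{real_inner,complete_space} set \<Rightarrow> 'a \<Rightarrow> 'a" where
  "metric_proj C x = (THE p. p \<in> C \<and> (\<forall>y\<in>C. dist x p \<le> dist x y))"

definition Fix :: "('a \<Rightarrow> 'a) \<Rightarrow> 'a set" where
  "Fix G = {x. G x = x}"

definition BAM_with :: "real \<Rightarrow> ('a::{real_inner,complete_space} \<Rightarrow> 'a) \<Rightarrow> bool" where
  "BAM_with \<gamma> G \<longleftrightarrow>
     0 \<le> \<gamma> \<and> \<gamma> < 1 \<and>
     Fix G \<noteq> {} \<and> closed (Fix G) \<and> convex (Fix G) \<and>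
     metric_proj (Fix G) \<circ> G = metric_proj (Fix G) \<and>
     (\<forall>x. norm (G x - metric_proj (Fix G) x) \<le> \<gamma> * norm (x - metric_proj (Fix G) x))"

definition BAM :: "('a::{real_inner,complete_space} \<Rightarrow> 'a) \<Rightarrow> bool" where
  "BAM G \<longleftrightarrow> (\<exists>\<gamma>. BAM_with \<gamma> G)"

end

theory Submission
  imports Defs
begin

text \<open>
  Everything rests on the variational inequality that characterises projections.  Let \<open>k\<close> be the
  projection of \<open>x\<close> onto the cone \<open>K\<close>.  Then \<open>x - k\<close> is orthogonal to \<open>k\<close> and makes a nonpositive
  inner product with every element of \<open>K\<close>.  The projection \<open>p\<close> of \<open>k\<close> onto the ball is a nonnegative
  multiple of \<open>k\<close>, so \<open>x - k\<close> is orthogonal to \<open>p\<close> as well, and adding the inequality for \<open>p\<close> shows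
  that \<open>p\<close> is the projection of \<open>x\<close> onto the intersection.  A projection is always a 0-BAM.

  For the composition in the other order, \<open>(4, -3)\<close> is mapped to \<open>(4/5, 0)\<close>, which is fixed; but
  \<open>(1, 0)\<close> is a fixed point that is closer to \<open>(4, -3)\<close>, so condition (2) fails.
\<close>

section \<open>Existence of nearest points in Hilbert space\<close>

lemma dist_le_infdist_parallelogram:
  fixes x :: "'a::real_inner"
  assumes "convex C" "y \<in> C" "z \<in> C"
    and "(dist x y)\<^sup>2 \<le> (infdist x C)\<^sup>2 + e" "(dist x z)\<^sup>2 \<le> (infdist x C)\<^sup>2 + e"
  shows "(dist y z)\<^sup>2 \<le> 4 * e"
proof -
  let ?m = "(1/2) *\<^sub>R y + (1/2) *\<^sub>R z"
  have "?m \<in> C"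
    using convexD[OF assms(1-3), of "1/2" "1/2"] by simp
  then have "(infdist x C)\<^sup>2 \<le> (dist x ?m)\<^sup>2"
    by (intro power_mono infdist_le infdist_nonneg)
  \<comment> \<open>The parallelogram law for \<open>x - y\<close> and \<open>x - z\<close>. The
    midpoint lies in \<open>C\<close>, so the last term is at most -4 times the squared infimum and
    cancels the infima in the first two.\<close>
  moreover have "(dist y z)\<^sup>2 = 2 * (dist x y)\<^sup>2 + 2 * (dist x z)\<^sup>2 - 4 * (dist x ?m)\<^sup>2"
    by (simp add: dist_norm power2_norm_eq_inner inner_commute algebra_simps)
  ultimately show ?thesis
    using assms(4,5) by linarith
qed

text \<open>Completeness replaces compactness: the closed sets \<open>S n\<close> of almost nearest
  points decrease, and by the parallelogram estimate their diameters tend to 0, so they share a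
  point. The slack tends to 0, so that point attains the infimum.\<close>

lemma nearest_point_exists:
  fixes C :: "'a::{real_inner,complete_space} set"
  assumes "C \<noteq> {}" "closed C" "convex C"
  obtains p where "p \<in> C" "\<And>y. y \<in> C \<Longrightarrow> dist x p \<le> dist x y"
proof -
  define d where "d = infdist x C"
  define S where "S n = {y \<in> C. (dist x y)\<^sup>2 \<le> d\<^sup>2 + inverse (real (Suc n))}" for n
  have "closed (S n)" for n
  proof -
    have "S n = C \<inter> {y. (dist x y)\<^sup>2 \<le> d\<^sup>2 + inverse (real (Suc n))}"
      by (auto simp: S_def)
    then show ?thesis
      using assms(2) by (auto intro!: closed_Int closed_Collect_le continuous_intros)
  qed
  moreover have "S n \<noteq> {}" for n
  proof -
    define r where "r = sqrt (d\<^sup>2 + inverse (real (Suc n)))"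
    have "d < r"
      unfolding r_def by (rule real_less_rsqrt) simp
    then obtain y where "y \<in> C" "dist x y < r"
      using assms(1) cInf_lessD[of "dist x ` C" r] by (auto simp: d_def infdist_def)
    moreover from this have "(dist x y)\<^sup>2 \<le> r\<^sup>2"
      by (intro power_mono) auto
    ultimately show ?thesis
      by (auto simp: S_def r_def)
  qed
  moreover have "S n \<subseteq> S m" if "m \<le> n" for m n
  proof -
    have "inverse (real (Suc n)) \<le> inverse (real (Suc m))"
      using that by (intro le_imp_inverse_le) auto
    then show ?thesis unfolding S_def by (intro Collect_mono) linarith
  qed
  moreover have "\<exists>n. \<forall>y\<in>S n. \<forall>z\<in>S n. dist y z < e" if "e > 0" for e
  proof -
    obtain n where n: "inverse (real (Suc n)) < e\<^sup>2 / 4"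
      using reals_Archimedean[of "e\<^sup>2 / 4"] \<open>e > 0\<close> by auto
    have "dist y z < e" if "y \<in> S n" "z \<in> S n" for y z
    proof -
      have "(dist y z)\<^sup>2 \<le> 4 * inverse (real (Suc n))"
        using that by (intro dist_le_infdist_parallelogram[OF assms(3)]) (auto simp: S_def d_def)
      also have "\<dots> < e\<^sup>2" using n by simp
      finally show ?thesis using \<open>e > 0\<close> by (simp add: power_less_imp_less_base)
    qed
    then show ?thesis by blast
  qed
  ultimately obtain p where p: "\<And>n. p \<in> S n"
    using decreasing_closed_nest[of S] by blast
  have "(dist x p)\<^sup>2 \<le> d\<^sup>2"
  proof (rule field_le_epsilon)
    fix e :: real assume "e > 0"
    then obtain n where "inverse (real (Suc n)) < e"
      using reals_Archimedean by blast
    then show "(dist x p)\<^sup>2 \<le> d\<^sup>2 + e"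
      using p[of n] by (simp add: S_def)
  qed
  then have "dist x p \<le> d"
    by (rule power2_le_imp_le) (simp add: d_def infdist_nonneg)
  then have "dist x p \<le> dist x y" if "y \<in> C" for y
    using infdist_le[OF that, of x] by (simp add: d_def)
  then show thesis
    using that p[of 0] by (auto simp: S_def)
qed

section \<open>Variational characterisation of the projection\<close>

lemma metric_proj_eqI:
  fixes p :: "'a::{real_inner,complete_space}"
  assumes "p \<in> C" and le: "\<And>y. y \<in> C \<Longrightarrow> (x - p) \<bullet> (y - p) \<le> 0"
  shows "metric_proj C x = p"
proof -
  \<comment> \<open>Expanding the square about \<open>p\<close> gives one estimate for both goals:
    minimality of \<open>p\<close>, and \<open>dist p q = 0\<close> for any other minimiser
    \<open>q\<close>.\<close>
  have *: "(dist x p)\<^sup>2 + (dist p y)\<^sup>2 \<le> (dist x y)\<^sup>2" if "y \<in> C" for y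
    using le[OF that]
    by (simp add: dist_norm power2_norm_eq_inner inner_commute algebra_simps)
  show ?thesis
    unfolding metric_proj_def
  proof (rule the_equality)
    have "dist x p \<le> dist x y" if "y \<in> C" for y
      using *[OF that] zero_le_power2[of "dist p y"]
      by (intro power2_le_imp_le[of "dist x p"]) (linarith, simp)
    then show "p \<in> C \<and> (\<forall>y\<in>C. dist x p \<le> dist x y)"
      using assms(1) by blast
  next
    fix q assume q: "q \<in> C \<and> (\<forall>y\<in>C. dist x q \<le> dist x y)"
    then have "(dist x q)\<^sup>2 \<le> (dist x p)\<^sup>2"
      using assms(1) by (intro power_mono) auto
    with *[of q] q have "(dist p q)\<^sup>2 \<le> 0" by linarith
    then show "q = p" by simp
  qed
qed

text \<open>If the inner product were positive, a small step from \<open>p\<close> towards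
  \<open>y\<close> would come closer to \<open>x\<close>, and convexity keeps that step in
  \<open>C\<close>.\<close>

lemma nearest_point_variational:
  fixes p :: "'a::real_inner"
  assumes "convex C" "p \<in> C" "y \<in> C" and near: "\<And>y. y \<in> C \<Longrightarrow> dist x p \<le> dist x y"
  shows "(x - p) \<bullet> (y - p) \<le> 0"
proof (rule ccontr)
  assume "\<not> ?thesis"
  then obtain u where u: "0 < u" "u \<le> 1" "dist (p + u *\<^sub>R (y - p)) x < dist p x"
    using closer_point_lemma[of x p y] by (auto simp: dist_commute)
  have "p + u *\<^sub>R (y - p) = (1 - u) *\<^sub>R p + u *\<^sub>R y"
    by (simp add: algebra_simps)
  also have "\<dots> \<in> C"
    using convexD[OF assms(1-3), of "1 - u" u] u by simp
  finally show False
    using near u(3) by (metis dist_commute not_less)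
qed

lemma metric_proj_nearest:
  fixes C :: "'a::{real_inner,complete_space} set"
  assumes "C \<noteq> {}" "closed C" "convex C"
  shows metric_proj_in: "metric_proj C x \<in> C"
    and metric_proj_dist_le: "y \<in> C \<Longrightarrow> dist x (metric_proj C x) \<le> dist x y"
    and metric_proj_inner_le: "y \<in> C \<Longrightarrow> (x - metric_proj C x) \<bullet> (y - metric_proj C x) \<le> 0"
proof -
  obtain p where p: "p \<in> C" "\<And>y. y \<in> C \<Longrightarrow> dist x p \<le> dist x y"
    using nearest_point_exists[OF assms] by metis
  then have le: "(x - p) \<bullet> (y - p) \<le> 0" if "y \<in> C" for y
    using nearest_point_variational assms(3) that by blast
  with p have "metric_proj C x = p" by (intro metric_proj_eqI)
  with p le show "metric_proj C x \<in> C"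
    and "y \<in> C \<Longrightarrow> dist x (metric_proj C x) \<le> dist x y"
    and "y \<in> C \<Longrightarrow> (x - metric_proj C x) \<bullet> (y - metric_proj C x) \<le> 0"
    by auto
qed

lemma metric_proj_self: "x \<in> C \<Longrightarrow> metric_proj C x = x"
  by (rule metric_proj_eqI) auto

text \<open>The fixed points of the projection are exactly \<open>C\<close>, so condition (2) is
  idempotence and condition (3) compares the projection with itself.\<close>

lemma BAM_with_0_metric_proj:
  fixes C :: "'a::{real_inner,complete_space} set"
  assumes "C \<noteq> {}" "closed C" "convex C"
  shows "BAM_with 0 (metric_proj C)"
proof -
  have "Fix (metric_proj C) = C"
    unfolding Fix_def using metric_proj_in[OF assms] metric_proj_self by (metis (mono_tags, lifting) Collect_cong Collect_mem_eq)
  then show ?thesis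
    using assms by (simp add: BAM_with_def fun_eq_iff metric_proj_self metric_proj_in)
qed

section \<open>Projections onto balls and cones\<close>

lemma metric_proj_ball:
  fixes x :: "'a::{real_inner,complete_space}"
  assumes "\<rho> > 0"
  shows "metric_proj {y. norm y \<le> \<rho>} x = (if norm x \<le> \<rho> then x else (\<rho> / norm x) *\<^sub>R x)"
proof (cases "norm x \<le> \<rho>")
  case True
  then show ?thesis by (simp add: metric_proj_self)
next
  case False
  define t where "t = \<rho> / norm x"
  have t: "0 \<le> t" "t \<le> 1" "t * norm x = \<rho>"
    using False assms by (auto simp: t_def divide_simps)
  have "metric_proj {y. norm y \<le> \<rho>} x = t *\<^sub>R x"
  proof (rule metric_proj_eqI)
    show "t *\<^sub>R x \<in> {y. norm y \<le> \<rho>}" using t by simp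
  next
    fix y :: 'a assume "y \<in> {y. norm y \<le> \<rho>}"
    then have "norm x * norm y \<le> norm x * (t * norm x)"
      using t by (intro mult_left_mono) auto
    then have "x \<bullet> y \<le> t * (x \<bullet> x)"
      using norm_cauchy_schwarz[of x y]
      by (simp add: power2_norm_eq_inner[symmetric] power2_eq_square algebra_simps)
    \<comment> \<open>This product is the inner product of the variational inequality,
      factored.\<close>
    then have "(1 - t) * (x \<bullet> y - t * (x \<bullet> x)) \<le> 0"
      using t by (intro mult_nonneg_nonpos) auto
    then show "(x - t *\<^sub>R x) \<bullet> (y - t *\<^sub>R x) \<le> 0"
      by (simp add: algebra_simps)
  qed
  with False show ?thesis by (simp add: t_def)
qed

lemma metric_proj_cone:
  fixes K :: "'a::{real_inner,complete_space} set"
  assumes "K \<noteq> {}" "closed K" "convex K" "cone K"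
  shows metric_proj_cone_orthogonal: "(x - metric_proj K x) \<bullet> metric_proj K x = 0"
    and metric_proj_cone_polar: "y \<in> K \<Longrightarrow> (x - metric_proj K x) \<bullet> y \<le> 0"
proof -
  define k where "k = metric_proj K x"
  have k: "k \<in> K" and le: "\<And>y. y \<in> K \<Longrightarrow> (x - k) \<bullet> (y - k) \<le> 0"
    using metric_proj_nearest[OF assms(1-3)] by (auto simp: k_def)
  have "(x - k) \<bullet> (c *\<^sub>R k - k) \<le> 0" if "c \<ge> 0" for c
    using le mem_cone[OF assms(4) k that] by blast
  \<comment> \<open>The multiples 0 and 2 of \<open>k\<close> move away from \<open>k\<close> in
    opposite directions, which bounds \<open>(x - k) \<bullet> k\<close> from both sides.\<close>
  from this[of 0] this[of 2] have orth: "(x - k) \<bullet> k = 0"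
    by (simp add: inner_diff_right)
  then show "(x - metric_proj K x) \<bullet> metric_proj K x = 0" by (simp add: k_def)
  show "(x - metric_proj K x) \<bullet> y \<le> 0" if "y \<in> K"
    using le[OF that] orth by (simp add: k_def inner_diff_right)
qed

lemma metric_proj_ball_cone:
  fixes K :: "'a::{real_inner,complete_space} set"
  assumes K: "K \<noteq> {}" "closed K" "convex K" "cone K" and "\<rho> > 0"
  defines "B \<equiv> {x. norm x \<le> \<rho>}"
  shows "metric_proj B (metric_proj K x) = metric_proj (K \<inter> B) x"
proof -
  define k where "k = metric_proj K x"
  define p where "p = metric_proj B k"
  have B: "B = cball 0 \<rho>" by (auto simp: B_def)
  have B_props: "B \<noteq> {}" "closed B" "convex B"
    using \<open>\<rho> > 0\<close> by (auto simp: B)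
  \<comment> \<open>This form serves twice: it puts \<open>p\<close> in the cone and carries
    orthogonality to \<open>x - k\<close> over from \<open>k\<close> to \<open>p\<close>.\<close>
  obtain t where t: "t \<ge> 0" "p = t *\<^sub>R k"
  proof (cases "norm k \<le> \<rho>")
    case True
    with that[of 1] show ?thesis
      using \<open>\<rho> > 0\<close> by (simp add: p_def B_def metric_proj_ball)
  next
    case False
    with that[of "\<rho> / norm k"] show ?thesis
      using \<open>\<rho> > 0\<close> by (simp add: p_def B_def metric_proj_ball)
  qed
  have "metric_proj (K \<inter> B) x = p"
  proof (rule metric_proj_eqI)
    show "p \<in> K \<inter> B"
      using metric_proj_in[OF K(1-3)] metric_proj_in[OF B_props] mem_cone[OF K(4)] t
      by (metis IntI k_def p_def)
  next
    fix y assume y: "y \<in> K \<inter> B"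
    have "(x - k) \<bullet> p = 0"
      using metric_proj_cone_orthogonal[OF K] by (simp add: t k_def)
    moreover have "(x - k) \<bullet> y \<le> 0"
      using metric_proj_cone_polar[OF K] y by (simp add: k_def)
    moreover have "(k - p) \<bullet> (y - p) \<le> 0"
      using metric_proj_inner_le[OF B_props] y by (simp add: p_def)
    \<comment> \<open>Split \<open>x - p\<close> as \<open>(x - k) + (k - p)\<close>.\<close>
    ultimately show "(x - p) \<bullet> (y - p) \<le> 0"
      by (simp add: inner_diff_left inner_diff_right)
  qed
  then show ?thesis by (simp add: p_def k_def)
qed

section \<open>The counterexample in the plane\<close>

lemma metric_proj_orthant:
  fixes x :: "real^'n"
  shows "metric_proj {x. \<forall>i. 0 \<le> x $ i} x = (\<chi> i. max 0 (x $ i))"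
  \<comment> \<open>Each coordinate contributes a nonpositive term: its first factor vanishes if
    \<open>x $ i\<close> is nonnegative, and otherwise the term is
    \<open>x $ i * y $ i\<close>.\<close>
  by (rule metric_proj_eqI)
    (auto simp: inner_vec_def max_def mult_nonpos_nonneg intro!: sum_nonpos)

lemma not_BAM_orthant_disc:
  defines "K \<equiv> {x :: real^2. \<forall>i. 0 \<le> x $ i}" and "B \<equiv> {x :: real^2. norm x \<le> 1}"
  shows "\<not> BAM (metric_proj K \<circ> metric_proj B)"
proof
  let ?G = "metric_proj K \<circ> metric_proj B"
  assume "BAM ?G"
  then have F: "Fix ?G \<noteq> {}" "closed (Fix ?G)" "convex (Fix ?G)"
    and proj: "\<And>x. metric_proj (Fix ?G) (?G x) = metric_proj (Fix ?G) x"
    by (auto simp: BAM_def BAM_with_def fun_eq_iff)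
  \<comment> \<open>As \<open>x\<close> has norm 5, the disc sends it to (4/5, -3/5) and the orthant
    then clips this to \<open>p\<close>. The squared distances from \<open>x\<close> are 19.24 to
    \<open>p\<close> but only 18 to \<open>q\<close>.\<close>
  define x p q :: "real^2" where "x = vector [4, -3]" and "p = vector [4/5, 0]"
    and "q = vector [1, 0]"
  note norms = norm_vec_def L2_set_def sum_2 vector_2
  have fixed: "y \<in> Fix ?G" if "y \<in> K" "y \<in> B" for y
    using that by (simp add: Fix_def metric_proj_self)
  have "p \<in> K" "p \<in> B" "q \<in> K" "q \<in> B"
    by (auto simp: p_def q_def K_def B_def forall_2 norms power2_eq_square)
  then have "p \<in> Fix ?G" "q \<in> Fix ?G"
    by (auto intro: fixed)
  have "norm x = 5"
    by (simp add: x_def norms)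
  then have "metric_proj B x = (1/5) *\<^sub>R x"
    by (simp add: B_def metric_proj_ball)
  moreover have "metric_proj K ((1/5) *\<^sub>R x) = p"
    unfolding K_def metric_proj_orthant by (simp add: vec_eq_iff forall_2 x_def p_def)
  ultimately have "?G x = p"
    by simp
  \<comment> \<open>Since \<open>p\<close> is its own projection, condition (2) at \<open>x\<close>
    would make \<open>p\<close> the fixed point nearest to \<open>x\<close>.\<close>
  with proj[of x] \<open>p \<in> Fix ?G\<close> have "metric_proj (Fix ?G) x = p"
    by (simp add: metric_proj_self)
  with metric_proj_dist_le[OF F \<open>q \<in> Fix ?G\<close>, of x] have "dist x p \<le> dist x q"
    by simp
  then show False
    by (simp add: dist_norm x_def p_def q_def norms power2_eq_square)
qed

theorem proposition4p7:
  shows "(\<forall>(K :: 'a::{real_inner,complete_space} set) (\<rho>::real).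
            K \<noteq> {} \<and> closed K \<and> convex K \<and> cone K \<and> \<rho> > 0 \<longrightarrow>
            (let B = {x::'a. norm x \<le> \<rho>} in
               metric_proj B \<circ> metric_proj K = metric_proj (K \<inter> B) \<and>
               BAM_with 0 (metric_proj B \<circ> metric_proj K)))
       \<and> (let K = {x :: real^2. \<forall>i. 0 \<le> x $ i}; B = {x :: real^2. norm x \<le> 1} in
            \<not> BAM (metric_proj K \<circ> metric_proj B))"
proof (intro conjI allI impI)
  fix K :: "'a set" and \<rho> :: real
  assume "K \<noteq> {} \<and> closed K \<and> convex K \<and> cone K \<and> \<rho> > 0"
  then have K: "K \<noteq> {}" "closed K" "convex K" "cone K" and "\<rho> > 0" by auto
  define B where "B = {x::'a. norm x \<le> \<rho>}"
  have B: "B = cball 0 \<rho>" by (auto simp: B_def)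
  \<comment> \<open>The apex of the cone witnesses that the intersection is nonempty.\<close>
  have "0 \<in> K \<inter> B"
    using K \<open>\<rho> > 0\<close> cone_0 by (auto simp: B cone_contains_0)
  then have "BAM_with 0 (metric_proj (K \<inter> B))"
    using K by (intro BAM_with_0_metric_proj closed_Int convex_Int) (auto simp: B)
  moreover have "metric_proj B \<circ> metric_proj K = metric_proj (K \<inter> B)"
    using metric_proj_ball_cone[OF K \<open>\<rho> > 0\<close>] by (simp add: B_def fun_eq_iff)
  ultimately show "let B = {x::'a. norm x \<le> \<rho>} in
      metric_proj B \<circ> metric_proj K = metric_proj (K \<inter> B) \<and>
      BAM_with 0 (metric_proj B \<circ> metric_proj K)"
    by (simp add: B_def Let_def)
qed (use not_BAM_orthant_disc in \<open>simp add: Let_def\<close>)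

end
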